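(* Let $(\Omega,\mathcal{A},\mu)$ be a measure space for which there is a countable family $\{A_n:n\in\mathbb{N}\}\subset\mathcal{A}$ of mutually disjoint measurable sets such that $\mu(A_n)>0$ for all $n\in\mathbb{N}$ and $\lim_{n\to\infty}\mu(A_n)=0$. Then $(\mathcal{S}_c\cap\mathcal{S}_{au})\setminus\mathcal{S}_u$ is strongly $\mathfrak{c}$-algebrable. In particular, $\mathcal{S}_c\setminus\mathcal{S}_u$ and $\mathcal{S}_{au}\setminus\mathcal{S}_u$ are strongly $\mathfrak{c}$-algebrable.
   Context: $(\Omega,\mathcal{A},\mu)$ is a positive measure space. $L_0$ is the real vector space of ($\mu$-a.e. equality classes of) measurable functions $f:\Omega\to\mathbb{R}$. $L_0^{\mathbb{N}}$ is the commutative real algebra of all sequences $(f_n)_{n\in\mathbb{N}}$ in $L_0$ with coordinatewise operations, in particular $(f_n)\cdot(g_n):=(f_ng_n)$. Subsets of $L_0^{\mathbb{N}}$: $\mathcal{S}_u$: sequences with $f_n\to0$ uniformly almost everywhere (there is $Z\in\mathcal{A}$ with $\mu(Z)=0$ and $f_n\to0$ uniformly on $\Omega\setminus Z$). $\mathcal{S}_{au}$: $f_n\to0$ almost uniformly (for every $\varepsilon>0$ there is $Z_\varepsilon\in\mathcal{A}$ with $\mu(Z_\varepsilon)<\varepsilon$ and $f_n\to0$ uniformly on $\Omega\setminus Z_\varepsilon$). $\mathcal{S}_c$: $f_n\to0$ completely ($\sum_{n=1}^\infty\mu(\{|f_n|>\varepsilon\})<\infty$ for every $\varepsilon>0$). $\mathfrak{c}$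 is the cardinality of the continuum. A subset $A$ of a commutative algebra is strongly $\mathfrak{c}$-algebrable if there is a $\mathfrak{c}$-generated free algebra $M$ with $M\setminus\{0\}\subset A$; that is, there is a subset $B$ of the algebra of cardinality $\mathfrak{c}$ such that for any positive integer $N$, any nonzero real polynomial $P$ in $N$ variables without constant term and any distinct $x_1,\dots,x_N\in B$, one has $P(x_1,\dots,x_N)\in A\setminus\{0\}$. *)

theory Defs
  imports
    "HOL-Analysis.Analysis"
    "HOL-Algebra.Module"
    "HOL-Library.Poly_Mapping"
    "HOL-Library.Equipollence"
begin

section \<open>The algebra of sequences of classes of measurable functions\<close>

definition ae_rel :: "'a measure \<Rightarrow> (('a \<Rightarrow> real) \<times> ('a \<Rightarrow> real)) set" where
  "ae_rel M = {(f, g). f \<in> borel_measurable M \<and> g \<in> borel_measurable M \<and> (AE x in M. f x = g x)}"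

text \<open>The unions below range over all representatives; by compatibility with \<^const>\<open>ae_rel\<close>
  they collapse to the class of the result for any choice of representatives.\<close>

definition L0 :: "'a measure \<Rightarrow> (real, ('a \<Rightarrow> real) set) module" where
  "L0 M = \<lparr>carrier = borel_measurable M // ae_rel M,
     mult = (\<lambda>X Y. \<Union>f\<in>X. \<Union>g\<in>Y. ae_rel M `` {\<lambda>x. f x * g x}),
     one = ae_rel M `` {\<lambda>x. 1},
     zero = ae_rel M `` {\<lambda>x. 0},
     add = (\<lambda>X Y. \<Union>f\<in>X. \<Union>g\<in>Y. ae_rel M `` {\<lambda>x. f x + g x}),
     smult = (\<lambda>c X. \<Union>f\<in>X. ae_rel M `` {\<lambda>x. c * f x})\<rparr>"

definition seq_algebra :: "('s, 'b) module \<Rightarrow> ('s, nat \<Rightarrow> 'b) module" where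
  "seq_algebra L = \<lparr>carrier = {F. \<forall>n. F n \<in> carrier L},
     mult = (\<lambda>F G n. F n \<otimes>\<^bsub>L\<^esub> G n),
     one = (\<lambda>n. \<one>\<^bsub>L\<^esub>),
     zero = (\<lambda>n. \<zero>\<^bsub>L\<^esub>),
     add = (\<lambda>F G n. F n \<oplus>\<^bsub>L\<^esub> G n),
     smult = (\<lambda>c F n. c \<odot>\<^bsub>L\<^esub> F n)\<rparr>"

abbreviation L0_seq :: "'a measure \<Rightarrow> (real, nat \<Rightarrow> ('a \<Rightarrow> real) set) module" where
  "L0_seq M \<equiv> seq_algebra (L0 M)"

section \<open>Modes of convergence to zero\<close>

definition tendsto0_unif_ae :: "'a measure \<Rightarrow> (nat \<Rightarrow> 'a \<Rightarrow> real) \<Rightarrow> bool" where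
  "tendsto0_unif_ae M f \<longleftrightarrow>
     (\<exists>Z\<in>sets M. emeasure M Z = 0 \<and> uniform_limit (space M - Z) f (\<lambda>x. 0) sequentially)"

definition tendsto0_almost_unif :: "'a measure \<Rightarrow> (nat \<Rightarrow> 'a \<Rightarrow> real) \<Rightarrow> bool" where
  "tendsto0_almost_unif M f \<longleftrightarrow>
     (\<forall>\<epsilon>::real>0. \<exists>Z\<in>sets M. emeasure M Z < ennreal \<epsilon> \<and>
        uniform_limit (space M - Z) f (\<lambda>x. 0) sequentially)"

text \<open>The sum is taken in \<^typ>\<open>ennreal\<close>, so finiteness expresses convergence.\<close>

definition tendsto0_completely :: "'a measure \<Rightarrow> (nat \<Rightarrow> 'a \<Rightarrow> real) \<Rightarrow> bool" where
  "tendsto0_completely M f \<longleftrightarrow>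
     (\<forall>\<epsilon>::real>0. suminf (\<lambda>n. emeasure M {x \<in> space M. \<bar>f n x\<bar> > \<epsilon>}) < \<infinity>)"

text \<open>Each mode of convergence depends only on the classes of the functions (see the lemmas at the
  end), so existence of one sequence of representatives with the property is the same as every
  sequence of representatives having it.\<close>

definition S_u :: "'a measure \<Rightarrow> (nat \<Rightarrow> ('a \<Rightarrow> real) set) set" where
  "S_u M = {F \<in> carrier (L0_seq M). \<exists>f. (\<forall>n. f n \<in> F n) \<and> tendsto0_unif_ae M f}"

definition S_au :: "'a measure \<Rightarrow> (nat \<Rightarrow> ('a \<Rightarrow> real) set) set" where
  "S_au M = {F \<in> carrier (L0_seq M). \<exists>f. (\<forall>n. f n \<in> F n) \<and> tendsto0_almost_unif M f}"

definition S_c :: "'a measure \<Rightarrow> (nat \<Rightarrow> ('a \<Rightarrow> real) set) set" where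
  "S_c M = {F \<in> carrier (L0_seq M). \<exists>f. (\<forall>n. f n \<in> F n) \<and> tendsto0_completely M f}"

section \<open>Strong algebrability\<close>

text \<open>A real polynomial in the variables \<open>0, \<dots>, N - 1\<close> is a finitely supported map from exponent
  vectors (themselves finitely supported) to coefficients. The zero exponent vector is the constant
  monomial.\<close>

definition polys_no_const :: "nat \<Rightarrow> ((nat \<Rightarrow>\<^sub>0 nat) \<Rightarrow>\<^sub>0 real) set" where
  "polys_no_const N =
     {P. (\<forall>m\<in>Poly_Mapping.keys P. Poly_Mapping.keys m \<subseteq> {..<N}) \<and> Poly_Mapping.lookup P 0 = 0}"

definition poly_eval ::
  "(real, 'b) module \<Rightarrow> ((nat \<Rightarrow>\<^sub>0 nat) \<Rightarrow>\<^sub>0 real) \<Rightarrow> (nat \<Rightarrow> 'b) \<Rightarrow> 'b" where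
  "poly_eval L P x =
     (\<Oplus>\<^bsub>L\<^esub>m\<in>Poly_Mapping.keys P. Poly_Mapping.lookup P m \<odot>\<^bsub>L\<^esub>
        (\<Otimes>\<^bsub>L\<^esub>i\<in>Poly_Mapping.keys m. x i [^]\<^bsub>L\<^esub> Poly_Mapping.lookup m i))"

definition strongly_c_algebrable :: "(real, 'b) module \<Rightarrow> 'b set \<Rightarrow> bool" where
  "strongly_c_algebrable L A \<longleftrightarrow>
     (\<exists>B \<subseteq> carrier L. B \<approx> (UNIV :: real set) \<and>
        (\<forall>N>0. \<forall>P\<in>polys_no_const N. \<forall>x. P \<noteq> 0 \<longrightarrow> inj_on x {..<N} \<longrightarrow> x ` {..<N} \<subseteq> B \<longrightarrow>
           poly_eval L P x \<in> A - {\<zero>\<^bsub>L\<^esub>}))"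

section \<open>Well-definedness\<close>

definition real_ring :: "real ring" where
  "real_ring = \<lparr>carrier = UNIV, mult = (*), one = 1, zero = 0, add = (+)\<rparr>"

lemma cring_real_ring: "cring real_ring"
  by (intro cringI abelian_groupI comm_monoidI)
     (auto simp: real_ring_def algebra_simps intro: exI[of _ "- _"])

lemma equiv_ae_rel: "equiv (borel_measurable M) (ae_rel M)"
  by (intro equivI refl_onI symI transI) (auto simp: ae_rel_def elim: AE_mp)

lemma L0_class:
  assumes "f \<in> borel_measurable M"
  shows "ae_rel M `` {f} \<in> carrier (L0 M)"
  using assms by (auto simp: L0_def quotientI)

lemma L0_cases:
  assumes "X \<in> carrier (L0 M)"
  obtains f where "f \<in> borel_measurable M" "X = ae_rel M `` {f}"
  using assms by (auto simp: L0_def elim: quotientE)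

lemma
  assumes f: "f \<in> borel_measurable M" and g: "g \<in> borel_measurable M"
  shows L0_add: "ae_rel M `` {f} \<oplus>\<^bsub>L0 M\<^esub> ae_rel M `` {g} = ae_rel M `` {\<lambda>x. f x + g x}"
    and L0_mult: "ae_rel M `` {f} \<otimes>\<^bsub>L0 M\<^esub> ae_rel M `` {g} = ae_rel M `` {\<lambda>x. f x * g x}"
proof -
  have "congruent2 (ae_rel M) (ae_rel M) (\<lambda>f g. ae_rel M `` {\<lambda>x. f x + g x})"
    "congruent2 (ae_rel M) (ae_rel M) (\<lambda>f g. ae_rel M `` {\<lambda>x. f x * g x})"
    by (intro congruent2I' equiv_class_eq[OF equiv_ae_rel]; auto simp: ae_rel_def elim: AE_mp)+
  from this[THEN UN_equiv_class2[OF equiv_ae_rel equiv_ae_rel _ f g]]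
  show "ae_rel M `` {f} \<oplus>\<^bsub>L0 M\<^esub> ae_rel M `` {g} = ae_rel M `` {\<lambda>x. f x + g x}"
    "ae_rel M `` {f} \<otimes>\<^bsub>L0 M\<^esub> ae_rel M `` {g} = ae_rel M `` {\<lambda>x. f x * g x}"
    by (simp_all add: L0_def)
qed

lemma L0_smult:
  assumes f: "f \<in> borel_measurable M"
  shows "c \<odot>\<^bsub>L0 M\<^esub> ae_rel M `` {f} = ae_rel M `` {\<lambda>x. c * f x}"
proof -
  have "congruent (ae_rel M) (\<lambda>f. ae_rel M `` {\<lambda>x. c * f x})"
    by (intro congruentI equiv_class_eq[OF equiv_ae_rel]) (auto simp: ae_rel_def elim: AE_mp)
  from UN_equiv_class[OF equiv_ae_rel this f] show ?thesis
    by (simp add: L0_def)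
qed

lemma L0_zero: "\<zero>\<^bsub>L0 M\<^esub> = ae_rel M `` {\<lambda>x. 0}"
  and L0_one: "\<one>\<^bsub>L0 M\<^esub> = ae_rel M `` {\<lambda>x. 1}"
  by (simp_all add: L0_def)

lemma L0_neg:
  assumes "X \<in> carrier (L0 M)"
  shows "\<exists>Y\<in>carrier (L0 M). Y \<oplus>\<^bsub>L0 M\<^esub> X = \<zero>\<^bsub>L0 M\<^esub>"
  using assms
proof (elim L0_cases)
  fix f assume f: "f \<in> borel_measurable M" "X = ae_rel M `` {f}"
  then show ?thesis
    by (intro bexI[of _ "ae_rel M `` {\<lambda>x. - f x}"]) (auto simp: L0_add L0_zero L0_class)
qed

lemma algebra_L0: "Module.algebra real_ring (L0 M)"
proof (rule algebraI)
  show "cring (L0 M)"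
    by (intro cringI abelian_groupI comm_monoidI L0_neg; (elim L0_cases)?)
       (auto simp: L0_add L0_mult L0_zero L0_one L0_class algebra_simps)
  show "cring real_ring"
    by (rule cring_real_ring)
qed (auto simp: real_ring_def L0_add L0_mult L0_smult L0_class algebra_simps
       elim!: L0_cases)

lemma algebra_seq_algebra:
  assumes "Module.algebra R L"
  shows "Module.algebra R (seq_algebra L)"
proof -
  interpret Module.algebra R L by fact
  have neg: "\<exists>G\<in>carrier (seq_algebra L). G \<oplus>\<^bsub>seq_algebra L\<^esub> F = \<zero>\<^bsub>seq_algebra L\<^esub>"
    if "F \<in> carrier (seq_algebra L)" for F
    using that by (intro bexI[of _ "\<lambda>n. \<ominus>\<^bsub>L\<^esub> F n"]) (auto simp: seq_algebra_def M.l_neg)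
  show ?thesis
  proof (rule algebraI)
    show "cring (seq_algebra L)"
      by (intro cringI abelian_groupI comm_monoidI neg)
         (auto simp: seq_algebra_def fun_eq_iff M.a_ac m_assoc l_distr intro: m_comm)
  qed (auto simp: seq_algebra_def fun_eq_iff R_cring smult_l_distr smult_r_distr smult_assoc1
         smult_assoc2)
qed

lemma algebra_L0_seq: "Module.algebra real_ring (L0_seq M)"
  by (intro algebra_seq_algebra algebra_L0)

lemma AE_eq_seqE:
  assumes "F \<in> carrier (L0_seq M)" "\<And>n. f n \<in> F n" "\<And>n. g n \<in> F n"
  obtains Z where "Z \<in> null_sets M" "\<And>n x. x \<in> space M - Z \<Longrightarrow> f n x = g n x"
    "\<And>n. f n \<in> borel_measurable M" "\<And>n. g n \<in> borel_measurable M"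
proof -
  have *: "(f n, g n) \<in> ae_rel M" for n
  proof -
    have "F n \<in> borel_measurable M // ae_rel M"
      using assms(1) by (auto simp: seq_algebra_def L0_def)
    then show ?thesis
      using assms(2,3)[of n] quotient_eq_iff[OF equiv_ae_rel] by metis
  qed
  then have "AE x in M. \<forall>n. f n x = g n x"
    by (subst AE_all_countable) (auto simp: ae_rel_def)
  then obtain Z where "{x \<in> space M. \<not> (\<forall>n. f n x = g n x)} \<subseteq> Z" "Z \<in> null_sets M"
    by (auto elim!: AE_E)
  with * that[of Z] show thesis
    by (auto simp: ae_rel_def)
qed

lemma tendsto0_unif_ae_representatives:
  assumes "F \<in> carrier (L0_seq M)" "\<And>n. f n \<in> F n" "\<And>n. g n \<in> F n" "tendsto0_unif_ae M f"
  shows "tendsto0_unif_ae M g"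
proof -
  obtain Z where Z: "Z \<in> null_sets M" "\<And>n x. x \<in> space M - Z \<Longrightarrow> f n x = g n x"
    using AE_eq_seqE[OF assms(1-3)] by metis
  obtain Y where Y: "Y \<in> null_sets M" "uniform_limit (space M - Y) f (\<lambda>x. 0) sequentially"
    using assms(4) by (auto simp: tendsto0_unif_ae_def null_sets_def)
  have "uniform_limit (space M - (Y \<union> Z)) f (\<lambda>x. 0) sequentially"
    by (rule uniform_limit_on_subset[OF Y(2)]) auto
  then have "uniform_limit (space M - (Y \<union> Z)) g (\<lambda>x. 0) sequentially"
    by (rule uniform_limit_cong'[THEN iffD1, rotated 2]) (use Z in auto)
  moreover have "Y \<union> Z \<in> null_sets M"
    using Y Z by blast
  ultimately show ?thesis
    unfolding tendsto0_unif_ae_def by (auto simp: null_sets_def)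
qed

lemma tendsto0_almost_unif_representatives:
  assumes "F \<in> carrier (L0_seq M)" "\<And>n. f n \<in> F n" "\<And>n. g n \<in> F n" "tendsto0_almost_unif M f"
  shows "tendsto0_almost_unif M g"
  unfolding tendsto0_almost_unif_def
proof (intro allI impI)
  fix \<epsilon> :: real assume "\<epsilon> > 0"
  obtain Z where Z: "Z \<in> null_sets M" "\<And>n x. x \<in> space M - Z \<Longrightarrow> f n x = g n x"
    using AE_eq_seqE[OF assms(1-3)] by metis
  obtain Y where Y: "Y \<in> sets M" "emeasure M Y < ennreal \<epsilon>"
    "uniform_limit (space M - Y) f (\<lambda>x. 0) sequentially"
    using assms(4) \<open>\<epsilon> > 0\<close> unfolding tendsto0_almost_unif_def by blast
  have "uniform_limit (space M - (Y \<union> Z)) f (\<lambda>x. 0) sequentially"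
    by (rule uniform_limit_on_subset[OF Y(3)]) auto
  then have "uniform_limit (space M - (Y \<union> Z)) g (\<lambda>x. 0) sequentially"
    by (rule uniform_limit_cong'[THEN iffD1, rotated 2]) (use Z in auto)
  moreover have "Y \<union> Z \<in> sets M" "emeasure M (Y \<union> Z) < ennreal \<epsilon>"
    using Y Z by (auto simp: emeasure_Un_null_set)
  ultimately show "\<exists>Z\<in>sets M. emeasure M Z < ennreal \<epsilon> \<and>
      uniform_limit (space M - Z) g (\<lambda>x. 0) sequentially"
    by blast
qed

lemma tendsto0_completely_representatives:
  assumes "F \<in> carrier (L0_seq M)" "\<And>n. f n \<in> F n" "\<And>n. g n \<in> F n" "tendsto0_completely M f"
  shows "tendsto0_completely M g"
proof -
  obtain Z where Z: "Z \<in> null_sets M" "\<And>n x. x \<in> space M - Z \<Longrightarrow> f n x = g n x"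
    and [measurable]: "\<And>n. f n \<in> borel_measurable M" "\<And>n. g n \<in> borel_measurable M"
    using AE_eq_seqE[OF assms(1-3)] by metis
  have "emeasure M {x \<in> space M. \<bar>f n x\<bar> > \<epsilon>} = emeasure M {x \<in> space M. \<bar>g n x\<bar> > \<epsilon>}" for n and \<epsilon> :: real
  proof (rule emeasure_eq_AE)
    show "AE x in M. (x \<in> {x \<in> space M. \<bar>f n x\<bar> > \<epsilon>}) = (x \<in> {x \<in> space M. \<bar>g n x\<bar> > \<epsilon>})"
      using AE_not_in[OF Z(1)] by eventually_elim (use Z(2) in auto)
  qed measurable
  with assms(4) show ?thesis
    by (simp add: tendsto0_completely_def)
qed

end

theory Submission
  imports Defs "HOL-Real_Asymp.Real_Asymp"
begin

text \<open>Choose sets \<open>D n\<close> among the \<open>A k\<close> with \<open>\<mu> (D n) < 2\<^bsup>-n\<^esup>\<close> and take as generators the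
  sequences \<open>exp (n\<^bsup>c\<^esup>) \<cdot> 1\<^bsub>D n\<^esub>\<close> with \<open>c > 0\<close>. A polynomial without constant term in such
  generators has the form \<open>p n \<cdot> 1\<^bsub>D n\<^esub>\<close>; by the choice of \<open>D\<close> it converges to zero completely and
  almost uniformly, and uniformly almost everywhere only if \<open>p n \<rightarrow> 0\<close>. This does not happen: for
  distinct exponents \<open>c\<close> the monomials in \<open>exp (n\<^bsup>c\<^esup>)\<close> are totally ordered by growth, and the
  dominant one, which is at least \<open>1\<close>, determines \<open>p\<close> asymptotically.\<close>

section \<open>Growth of generalised monomials\<close>

text \<open>Among the terms with nonzero coefficient the largest power of \<open>n\<close> wins:
  after factoring it out, the cofactor tends to its coefficient, whose sign decides between the two
  alternatives.\<close>

lemma sum_powr_at_top_or_at_bot: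
  fixes c d :: "'i \<Rightarrow> real"
  assumes I: "finite I" and inj: "inj_on c I" and pos: "\<And>i. i \<in> I \<Longrightarrow> c i > 0"
    and nz: "\<exists>i\<in>I. d i \<noteq> 0"
  shows "filterlim (\<lambda>n. \<Sum>i\<in>I. d i * real n powr c i) at_top sequentially \<or>
    filterlim (\<lambda>n. \<Sum>i\<in>I. d i * real n powr c i) at_bot sequentially"
proof -
  \<comment> \<open>Vanishing coefficients are discarded first, so that the maximal exponent over
    \<open>J\<close> belongs to a genuine term.\<close>
  define J where "J = {i\<in>I. d i \<noteq> 0}"
  have J: "finite J" "J \<noteq> {}" "J \<subseteq> I" using I nz by (auto simp: J_def)
  obtain k where k: "k \<in> J" "\<And>i. i \<in> J \<Longrightarrow> c i \<le> c k"
    using Max_in[of "c ` J"] Max_ge[of "c ` J"] J by fastforce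
  \<comment> \<open>Injectivity of \<open>c\<close> makes the maximum strict, hence every remaining
    exponent \<open>c i - c k\<close> is negative.\<close>
  have less: "c i < c k" if "i \<in> J - {k}" for i
    using that k(2)[of i] inj_onD[OF inj, of i k] J(3) k(1) by fastforce
  have sum: "(\<Sum>i\<in>I. d i * real n powr c i) =
      (d k + (\<Sum>i\<in>J-{k}. d i * real n powr (c i - c k))) * real n powr c k"
    if "n > 0" for n
  proof -
    have "(\<Sum>i\<in>I. d i * real n powr c i) = (\<Sum>i\<in>J. d i * real n powr c i)"
      by (rule sum.mono_neutral_right) (use I in \<open>auto simp: J_def\<close>)
    also have "\<dots> = d k * real n powr c k + (\<Sum>i\<in>J-{k}. d i * real n powr c i)"
      using J k by (simp add: sum.remove)
    finally show ?thesis
      using that by (simp add: distrib_right sum_distrib_right powr_diff)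
  qed
  have lim: "(\<lambda>n. d k + (\<Sum>i\<in>J-{k}. d i * real n powr (c i - c k))) \<longlonglongrightarrow> d k + (\<Sum>i\<in>J-{k}. d i * 0)"
    using less by (intro tendsto_intros tendsto_neg_powr filterlim_real_sequentially) auto
  have top: "filterlim (\<lambda>n. real n powr c k) at_top sequentially"
  proof -
    have "c k > 0" using J k pos by auto
    then show ?thesis by real_asymp
  qed
  have ev: "\<forall>\<^sub>F n in sequentially. (d k + (\<Sum>i\<in>J-{k}. d i * real n powr (c i - c k))) * real n powr c k
      = (\<Sum>i\<in>I. d i * real n powr c i)"
    using eventually_gt_at_top[of 0] by eventually_elim (simp add: sum)
  have "d k \<noteq> 0" using k by (simp add: J_def)
  then consider "d k > 0" | "d k < 0" by linarith
  then show ?thesis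
  proof cases
    case 1
    have "filterlim (\<lambda>n. \<Sum>i\<in>I. d i * real n powr c i) at_top sequentially"
      using filterlim_tendsto_pos_mult_at_top[OF lim _ top] 1 filterlim_cong[OF refl refl ev]
      by simp
    then show ?thesis ..
  next
    case 2
    have "filterlim (\<lambda>n. \<Sum>i\<in>I. d i * real n powr c i) at_bot sequentially"
      using filterlim_tendsto_neg_mult_at_bot[OF lim _ top] 2 filterlim_cong[OF refl refl ev]
      by simp
    then show ?thesis ..
  qed
qed

text \<open>Read \<open>E a\<close> as the logarithm of a monomial: the hypothesis says that any two
  are comparable by growth, and a finite nonempty set of them has a maximum. By induction, a new
  element either overtakes the old maximum or stays below it.\<close>

lemma dominant_element:
  fixes E :: "'b \<Rightarrow> nat \<Rightarrow> real"
  assumes "finite K" "K \<noteq> {}"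
    and "\<And>a b. a \<in> K \<Longrightarrow> b \<in> K \<Longrightarrow> a \<noteq> b \<Longrightarrow>
      filterlim (\<lambda>n. E a n - E b n) at_top sequentially \<or>
      filterlim (\<lambda>n. E a n - E b n) at_bot sequentially"
  shows "\<exists>a\<in>K. \<forall>b\<in>K - {a}. filterlim (\<lambda>n. E b n - E a n) at_bot sequentially"
  using assms
proof (induction K rule: finite_ne_induct)
  case (insert x K)
  obtain a where a: "a \<in> K" "\<And>b. b \<in> K - {a} \<Longrightarrow> filterlim (\<lambda>n. E b n - E a n) at_bot sequentially"
    using insert.IH insert.prems by (metis insertCI)
  have "a \<noteq> x" using a insert.hyps by auto
  then consider "filterlim (\<lambda>n. E x n - E a n) at_top sequentially"
    | "filterlim (\<lambda>n. E x n - E a n) at_bot sequentially"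
    using insert.prems[of x a] a by blast
  then show ?case
  proof cases
    case 1
    then have xa: "filterlim (\<lambda>n. E a n - E x n) at_bot sequentially"
      by (simp add: filterlim_uminus_at_top)
    \<comment> \<open>Transitivity of the growth order: \<open>E x - E b\<close> is the sum of
      \<open>E x - E a\<close> and \<open>E a - E b\<close>, both tending to infinity.\<close>
    have "filterlim (\<lambda>n. E b n - E x n) at_bot sequentially" if "b \<in> K" for b
    proof (cases "b = a")
      case False
      then show ?thesis
        using filterlim_at_top_add_at_top[of "\<lambda>n. E a n - E b n" _ "\<lambda>n. E x n - E a n"] a(2)[of b] 1 that
        by (simp add: filterlim_uminus_at_top)
    qed (use xa in simp)
    then show ?thesis by auto
  next
    case 2
    with a show ?thesis by (intro bexI[of _ a]) auto
  qed
qed auto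

section \<open>Evaluation of polynomials\<close>

text \<open>The real counterpart of \<open>poly_eval\<close>; applied pointwise to representatives,
  it gives a representative of the polynomial in the classes.\<close>

definition mpoly_fun :: "((nat \<Rightarrow>\<^sub>0 nat) \<Rightarrow>\<^sub>0 real) \<Rightarrow> (nat \<Rightarrow> real) \<Rightarrow> real" where
  "mpoly_fun P a = (\<Sum>m\<in>Poly_Mapping.keys P. Poly_Mapping.lookup P m *
     (\<Prod>i\<in>Poly_Mapping.keys m. a i ^ Poly_Mapping.lookup m i))"

text \<open>Without a constant term every monomial contains some variable, so all of them vanish off
  \<open>S\<close>; on \<open>S\<close> the indicator is 1.\<close>

lemma mpoly_fun_mult_indicator:
  assumes "Poly_Mapping.lookup P 0 = 0"
  shows "mpoly_fun P (\<lambda>i. a i * indicator S w) = mpoly_fun P a * indicator S w"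
proof (cases "w \<in> S")
  case False
  have "(\<Prod>i\<in>Poly_Mapping.keys m. (0::real) ^ Poly_Mapping.lookup m i) = 0"
    if "m \<in> Poly_Mapping.keys P" for m
  proof -
    have "m \<noteq> 0" using that assms by (auto simp: in_keys_iff)
    then obtain i where "i \<in> Poly_Mapping.keys m"
      by (metis keys_eq_empty all_not_in_conv)
    then show ?thesis
      by (auto simp: prod_zero_iff in_keys_iff)
  qed
  with False show ?thesis by (simp add: mpoly_fun_def sum.neutral del: prod_zero_iff)
qed simp

text \<open>Divided by its dominant monomial, the polynomial tends to the coefficient of that
  monomial, which is nonzero. As the dominant monomial is at least 1, a polynomial tending to 0
  would force this limit to be 0.\<close>

lemma mpoly_fun_exp_powr_not_tendsto_0:
  assumes P: "P \<in> polys_no_const N" "P \<noteq> 0"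
    and c: "inj_on c {..<N}" "\<And>i. c i > 0"
  shows "\<not> (\<lambda>n. mpoly_fun P (\<lambda>i. exp (real n powr c i))) \<longlonglongrightarrow> 0"
proof
  assume lim0: "(\<lambda>n. mpoly_fun P (\<lambda>i. exp (real n powr c i))) \<longlonglongrightarrow> 0"
  define K where "K = Poly_Mapping.keys P"
  \<comment> \<open>\<open>E m n\<close> is the logarithm of the monomial \<open>m\<close> at
    \<open>exp (n powr c i)\<close>. Summing over all \<open>i < N\<close>, not just over the keys
    of \<open>m\<close>, lets two monomials be subtracted termwise.\<close>
  define E where "E m n = (\<Sum>i<N. real (Poly_Mapping.lookup m i) * real n powr c i)"
    for m :: "nat \<Rightarrow>\<^sub>0 nat" and n :: nat
  have sub: "Poly_Mapping.keys m \<subseteq> {..<N}" if "m \<in> K" for m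
    using P that by (auto simp: polys_no_const_def K_def)
  have prod: "(\<Prod>i\<in>Poly_Mapping.keys m. exp (real n powr c i) ^ Poly_Mapping.lookup m i) = exp (E m n)"
    if "m \<in> K" for m n
  proof -
    have "(\<Prod>i\<in>Poly_Mapping.keys m. exp (real n powr c i) ^ Poly_Mapping.lookup m i)
        = exp (\<Sum>i\<in>Poly_Mapping.keys m. real (Poly_Mapping.lookup m i) * real n powr c i)"
      by (simp add: exp_sum exp_of_nat_mult)
    also have "(\<Sum>i\<in>Poly_Mapping.keys m. real (Poly_Mapping.lookup m i) * real n powr c i) = E m n"
      unfolding E_def using sub[OF that]
      by (intro sum.mono_neutral_left) (auto simp: in_keys_iff)
    finally show ?thesis .
  qed
  have "\<exists>a\<in>K. \<forall>b\<in>K - {a}. filterlim (\<lambda>n. E b n - E a n) at_bot sequentially"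
  proof (rule dominant_element)
    show "finite K" "K \<noteq> {}" using P by (auto simp: K_def)
    \<comment> \<open>Distinct exponent vectors differ at some index, necessarily a key of one of
      them and so below \<open>N\<close>; thus \<open>E a - E b\<close> is a nontrivial combination
      of distinct positive powers of \<open>n\<close>.\<close>
    fix a b assume ab: "a \<in> K" "b \<in> K" "a \<noteq> b"
    then obtain i where i: "Poly_Mapping.lookup a i \<noteq> Poly_Mapping.lookup b i"
      by (metis poly_mapping_eqI)
    then have "i \<in> Poly_Mapping.keys a \<union> Poly_Mapping.keys b"
      by (auto simp: in_keys_iff)
    then have "\<exists>i\<in>{..<N}. real (Poly_Mapping.lookup a i) - real (Poly_Mapping.lookup b i) \<noteq> 0"
      using sub ab i by (intro bexI[of _ i]) auto
    from sum_powr_at_top_or_at_bot[OF _ c(1) _ this] c(2)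
    show "filterlim (\<lambda>n. E a n - E b n) at_top sequentially \<or>
        filterlim (\<lambda>n. E a n - E b n) at_bot sequentially"
      by (simp add: E_def sum_subtractf left_diff_distrib)
  qed
  then obtain a where a: "a \<in> K"
    "\<And>b. b \<in> K - {a} \<Longrightarrow> filterlim (\<lambda>n. E b n - E a n) at_bot sequentially"
    by auto
  have eq: "mpoly_fun P (\<lambda>i. exp (real n powr c i)) / exp (E a n) = Poly_Mapping.lookup P a +
      (\<Sum>m\<in>K - {a}. Poly_Mapping.lookup P m * exp (E m n - E a n))" for n
  proof -
    have "mpoly_fun P (\<lambda>i. exp (real n powr c i)) = (\<Sum>m\<in>K. Poly_Mapping.lookup P m * exp (E m n))"
      unfolding mpoly_fun_def K_def[symmetric] by (intro sum.cong refl) (simp add: prod)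
    also have "\<dots> / exp (E a n) = (\<Sum>m\<in>K. Poly_Mapping.lookup P m * exp (E m n - E a n))"
      by (simp add: sum_divide_distrib exp_diff)
    also have "\<dots> = Poly_Mapping.lookup P a +
        (\<Sum>m\<in>K - {a}. Poly_Mapping.lookup P m * exp (E m n - E a n))"
      using a by (subst sum.remove[of _ a]) (auto simp: K_def)
    finally show ?thesis .
  qed
  have "(\<lambda>n. Poly_Mapping.lookup P a + (\<Sum>m\<in>K - {a}. Poly_Mapping.lookup P m * exp (E m n - E a n)))
      \<longlonglongrightarrow> Poly_Mapping.lookup P a + (\<Sum>m\<in>K - {a}. Poly_Mapping.lookup P m * 0)"
    using a(2) by (intro tendsto_intros filterlim_compose[OF exp_at_bot])
  then have lim: "(\<lambda>n. mpoly_fun P (\<lambda>i. exp (real n powr c i)) / exp (E a n))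
      \<longlonglongrightarrow> Poly_Mapping.lookup P a"
    unfolding eq by simp
  have E_nonneg: "E a n \<ge> 0" for n
    by (auto simp: E_def intro: sum_nonneg)
  \<comment> \<open>Dividing by \<open>exp (E a n)\<close>, which is at least 1, does not increase
    absolute values.\<close>
  have "(\<lambda>n. mpoly_fun P (\<lambda>i. exp (real n powr c i)) / exp (E a n)) \<longlonglongrightarrow> 0"
  proof (rule Lim_null_comparison[OF always_eventually tendsto_rabs_zero[OF lim0]], rule allI)
    fix n
    have "1 \<le> exp (E a n)" using E_nonneg[of n] by simp
    from frac_le[OF abs_ge_zero order_refl zero_less_one this]
    show "norm (mpoly_fun P (\<lambda>i. exp (real n powr c i)) / exp (E a n))
        \<le> \<bar>mpoly_fun P (\<lambda>i. exp (real n powr c i))\<bar>"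
      by simp
  qed
  then have "Poly_Mapping.lookup P a = 0"
    using lim LIMSEQ_unique by blast
  with a show False by (simp add: K_def in_keys_iff)
qed

section \<open>Sequences given by representatives\<close>

definition class_seq :: "'a measure \<Rightarrow> (nat \<Rightarrow> 'a \<Rightarrow> real) \<Rightarrow> nat \<Rightarrow> ('a \<Rightarrow> real) set" where
  "class_seq M f = (\<lambda>n. ae_rel M `` {f n})"

context
  fixes M :: "'a measure"
begin

interpretation Module.algebra real_ring "L0_seq M"
  by (rule algebra_L0_seq)

lemma class_seq_closed:
  "(\<And>n. f n \<in> borel_measurable M) \<Longrightarrow> class_seq M f \<in> carrier (L0_seq M)"
  by (simp add: class_seq_def seq_algebra_def L0_class)

lemma in_class_seq: "f n \<in> borel_measurable M \<Longrightarrow> f n \<in> class_seq M f n"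
  by (simp add: class_seq_def ae_rel_def)

lemma class_seq_pow:
  assumes "\<And>n. f n \<in> borel_measurable M"
  shows "class_seq M f [^]\<^bsub>L0_seq M\<^esub> (k::nat) = class_seq M (\<lambda>n x. f n x ^ k)"
proof (induction k)
  case 0
  show ?case by (simp add: class_seq_def) (simp add: seq_algebra_def L0_one)
next
  case (Suc k)
  have "(\<lambda>x. f n x ^ k) \<in> borel_measurable M" for n
    using assms by measurable
  with Suc assms show ?case
    by (simp add: class_seq_def) (simp add: seq_algebra_def L0_mult mult.commute)
qed

lemma class_seq_finprod:
  assumes "finite I" "\<And>i n. i \<in> I \<Longrightarrow> f i n \<in> borel_measurable M"
    "\<And>i. i \<in> I \<Longrightarrow> X i = class_seq M (f i)"
  shows "(\<Otimes>\<^bsub>L0_seq M\<^esub>i\<in>I. X i) = class_seq M (\<lambda>n x. \<Prod>i\<in>I. f i n x)"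
  using assms
proof (induction I rule: finite_induct)
  case empty
  show ?case by (simp add: class_seq_def) (simp add: seq_algebra_def L0_one)
next
  case (insert j I)
  have 1: "(\<lambda>x. \<Prod>i\<in>I. f i n x) \<in> borel_measurable M" for n
    using insert.prems by (intro borel_measurable_prod) auto
  have 2: "X i \<in> carrier (L0_seq M)" if "i \<in> insert j I" for i
    using insert.prems that by (metis class_seq_closed)
  have "(\<Otimes>\<^bsub>L0_seq M\<^esub>i\<in>insert j I. X i) = X j \<otimes>\<^bsub>L0_seq M\<^esub> (\<Otimes>\<^bsub>L0_seq M\<^esub>i\<in>I. X i)"
    using insert.hyps 2 by (intro finprod_insert) auto
  also have "(\<Otimes>\<^bsub>L0_seq M\<^esub>i\<in>I. X i) = class_seq M (\<lambda>n x. \<Prod>i\<in>I. f i n x)"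
    using insert by simp
  finally show ?case
    using insert.prems insert.hyps 1
    by (simp add: class_seq_def) (simp add: seq_algebra_def L0_mult)
qed

lemma class_seq_finsum:
  assumes "finite I" "\<And>i n. i \<in> I \<Longrightarrow> f i n \<in> borel_measurable M"
    "\<And>i. i \<in> I \<Longrightarrow> X i = class_seq M (f i)"
  shows "(\<Oplus>\<^bsub>L0_seq M\<^esub>i\<in>I. X i) = class_seq M (\<lambda>n x. \<Sum>i\<in>I. f i n x)"
  using assms
proof (induction I rule: finite_induct)
  case empty
  show ?case by (simp add: class_seq_def) (simp add: seq_algebra_def L0_zero)
next
  case (insert j I)
  have 1: "(\<lambda>x. \<Sum>i\<in>I. f i n x) \<in> borel_measurable M" for n
    using insert.prems by (intro borel_measurable_sum) auto
  have 2: "X i \<in> carrier (L0_seq M)" if "i \<in> insert j I" for i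
    using insert.prems that by (metis class_seq_closed)
  have "(\<Oplus>\<^bsub>L0_seq M\<^esub>i\<in>insert j I. X i) = X j \<oplus>\<^bsub>L0_seq M\<^esub> (\<Oplus>\<^bsub>L0_seq M\<^esub>i\<in>I. X i)"
    using insert.hyps 2 by (intro M.finsum_insert) auto
  also have "(\<Oplus>\<^bsub>L0_seq M\<^esub>i\<in>I. X i) = class_seq M (\<lambda>n x. \<Sum>i\<in>I. f i n x)"
    using insert by simp
  finally show ?case
    using insert.prems insert.hyps 1
    by (simp add: class_seq_def) (simp add: seq_algebra_def L0_add)
qed

lemma class_seq_smult:
  assumes "\<And>n. f n \<in> borel_measurable M"
  shows "c \<odot>\<^bsub>L0_seq M\<^esub> class_seq M f = class_seq M (\<lambda>n x. c * f n x)"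
  using assms by (simp add: class_seq_def) (simp add: seq_algebra_def L0_smult)

text \<open>The operations on classes are computed on representatives, so evaluation is too.
  Conditions for \<open>i < N\<close> suffice because \<open>P\<close> involves only these
  variables.\<close>

lemma poly_eval_class_seq:
  assumes P: "P \<in> polys_no_const N"
    and f: "\<And>i n. i < N \<Longrightarrow> f i n \<in> borel_measurable M"
    and X: "\<And>i. i < N \<Longrightarrow> X i = class_seq M (f i)"
  shows "poly_eval (L0_seq M) P X = class_seq M (\<lambda>n x. mpoly_fun P (\<lambda>i. f i n x))"
  unfolding poly_eval_def mpoly_fun_def
proof (rule class_seq_finsum)
  fix m assume "m \<in> Poly_Mapping.keys P"
  then have less: "i < N" if "i \<in> Poly_Mapping.keys m" for i
    using P that by (auto simp: polys_no_const_def)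
  have meas: "(\<lambda>x. \<Prod>i\<in>Poly_Mapping.keys m. f i n x ^ Poly_Mapping.lookup m i) \<in> borel_measurable M" for n
    using f less by (intro borel_measurable_prod borel_measurable_power) auto
  then show "(\<lambda>x. Poly_Mapping.lookup P m *
      (\<Prod>i\<in>Poly_Mapping.keys m. f i n x ^ Poly_Mapping.lookup m i)) \<in> borel_measurable M" for n
    by (intro borel_measurable_times) auto
  have "(\<Otimes>\<^bsub>L0_seq M\<^esub>i\<in>Poly_Mapping.keys m. X i [^]\<^bsub>L0_seq M\<^esub> Poly_Mapping.lookup m i) =
      class_seq M (\<lambda>n x. \<Prod>i\<in>Poly_Mapping.keys m. f i n x ^ Poly_Mapping.lookup m i)"
    using f less by (intro class_seq_finprod) (auto simp: X class_seq_pow)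
  then show "Poly_Mapping.lookup P m \<odot>\<^bsub>L0_seq M\<^esub>
      (\<Otimes>\<^bsub>L0_seq M\<^esub>i\<in>Poly_Mapping.keys m. X i [^]\<^bsub>L0_seq M\<^esub> Poly_Mapping.lookup m i) =
      class_seq M (\<lambda>n x. Poly_Mapping.lookup P m *
        (\<Prod>i\<in>Poly_Mapping.keys m. f i n x ^ Poly_Mapping.lookup m i))"
    using meas by (simp add: class_seq_smult)
qed simp

text \<open>Removing \<open>S_u M\<close> therefore also removes zero, which yields the nonvanishing
  demanded by strong algebrability.\<close>

lemma zero_in_S_u: "\<zero>\<^bsub>L0_seq M\<^esub> \<in> S_u M"
proof -
  have "\<zero>\<^bsub>L0_seq M\<^esub> = class_seq M (\<lambda>n x. 0)"
    by (simp add: seq_algebra_def class_seq_def L0_zero)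
  moreover have "tendsto0_unif_ae M (\<lambda>n x. 0)"
    unfolding tendsto0_unif_ae_def by (intro bexI[of _ "{}"]) (auto intro: uniform_limit_const)
  ultimately show ?thesis
    unfolding S_u_def using in_class_seq[of "\<lambda>n x. 0"] M.zero_closed by (auto intro!: exI[of _ "\<lambda>n x. 0"])
qed

end

section \<open>Multiples of indicators of sets of small measure\<close>

context
  fixes M :: "'a measure" and D :: "nat \<Rightarrow> 'a set"
  assumes sets [measurable]: "\<And>n. D n \<in> sets M"
    and pos: "\<And>n. emeasure M (D n) > 0"
begin

definition step_seq :: "(nat \<Rightarrow> real) \<Rightarrow> nat \<Rightarrow> 'a \<Rightarrow> real" where
  "step_seq u n w = u n * indicator (D n) w"

lemma step_seq_measurable [measurable]: "step_seq u n \<in> borel_measurable M"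
  unfolding step_seq_def by measurable

text \<open>Supplies a sample point of \<open>D n\<close> outside any given null set, at which
  \<open>step_seq u n\<close> takes the value \<open>u n\<close>.\<close>

lemma not_subset_null: "Z \<in> null_sets M \<Longrightarrow> \<exists>w\<in>D n. w \<in> space M - Z"
  using null_sets_subset[of Z M "D n"] sets[of n] sets.sets_into_space[OF sets[of n]] pos[of n]
  by (fastforce simp: null_sets_def)

text \<open>Almost everywhere equality still determines the coefficients, read off at sample points.
  This is what gives the generating set its cardinality.\<close>

lemma inj_class_seq_step_seq: "inj (\<lambda>u. class_seq M (step_seq u))"
proof (intro injI ext)
  fix u v n assume eq: "class_seq M (step_seq u) = class_seq M (step_seq v)"
  obtain Z where Z: "Z \<in> null_sets M" "\<And>n x. x \<in> space M - Z \<Longrightarrow> step_seq u n x = step_seq v n x"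
    using AE_eq_seqE[of "class_seq M (step_seq u)" M "step_seq u" "step_seq v"]
    by (metis class_seq_closed eq in_class_seq step_seq_measurable)
  obtain w where "w \<in> D n" "w \<in> space M - Z"
    using not_subset_null[OF Z(1)] by blast
  with Z(2)[of w n] show "u n = v n"
    by (simp add: step_seq_def)
qed

text \<open>The sample point in \<open>D n\<close> varies with \<open>n\<close>, which uniformity of
  the convergence permits.\<close>

lemma step_seq_unif_ae_imp:
  assumes "tendsto0_unif_ae M (step_seq u)"
  shows "u \<longlonglongrightarrow> 0"
proof -
  obtain Z where Z: "Z \<in> null_sets M" "uniform_limit (space M - Z) (step_seq u) (\<lambda>x. 0) sequentially"
    using assms by (auto simp: tendsto0_unif_ae_def null_sets_def)
  show ?thesis
  proof (rule tendstoI)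
    fix e :: real assume "e > 0"
    then have "\<forall>\<^sub>F n in sequentially. \<forall>x\<in>space M - Z. dist (step_seq u n x) 0 < e"
      using Z(2) by (auto simp: uniform_limit_iff)
    then show "\<forall>\<^sub>F n in sequentially. dist (u n) 0 < e"
    proof eventually_elim
      case (elim n)
      obtain w where "w \<in> D n" "w \<in> space M - Z"
        using not_subset_null[OF Z(1)] by blast
      with elim show ?case
        by (auto simp: step_seq_def dest!: bspec[of _ _ w])
    qed
  qed
qed

lemma class_seq_step_seq_in_S_u_imp:
  assumes "class_seq M (step_seq u) \<in> S_u M"
  shows "u \<longlonglongrightarrow> 0"
proof -
  obtain f where f: "\<And>n. f n \<in> class_seq M (step_seq u) n" "tendsto0_unif_ae M f"
    using assms by (auto simp: S_u_def)
  have "tendsto0_unif_ae M (step_seq u)"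
    by (rule tendsto0_unif_ae_representatives[OF _ f(1) _ f(2)])
       (auto intro: class_seq_closed in_class_seq)
  then show ?thesis by (rule step_seq_unif_ae_imp)
qed

section \<open>Summable measures: complete and almost uniform convergence\<close>

context
  assumes small: "\<And>n. emeasure M (D n) < ennreal ((1/2) ^ n)"
begin

text \<open>A geometric tail. The case \<open>k = 0\<close> serves complete convergence, large
  \<open>k\<close> almost uniform convergence.\<close>

lemma suminf_emeasure_tail_le: "suminf (\<lambda>n. emeasure M (D (n + k))) \<le> ennreal (2 * (1/2) ^ k)"
proof -
  have sums: "(\<lambda>n. (1/2::real) ^ (n + k)) sums (2 * (1/2) ^ k)"
    using sums_mult2[OF geometric_sums[of "1/2::real"], of "(1/2)^k"] by (simp add: power_add)
  have "suminf (\<lambda>n. emeasure M (D (n + k))) \<le> suminf (\<lambda>n. ennreal ((1/2) ^ (n + k)))"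
    using small by (intro suminf_le) (auto intro: less_imp_le)
  also have "\<dots> = ennreal (suminf (\<lambda>n. (1/2) ^ (n + k)))"
    using sums by (intro suminf_ennreal2) (auto intro: sums_summable)
  also have "\<dots> = ennreal (2 * (1/2) ^ k)"
    using sums by (simp add: sums_iff)
  finally show ?thesis .
qed

text \<open>Whatever the size of \<open>u\<close>, the set where the function exceeds
  \<open>e\<close> lies inside \<open>D n\<close>, and these measures are summable.\<close>

lemma class_seq_step_seq_in_S_c: "class_seq M (step_seq u) \<in> S_c M"
proof -
  have "tendsto0_completely M (step_seq u)"
    unfolding tendsto0_completely_def
  proof (intro allI impI)
    fix e :: real assume "e > 0"
    then have "emeasure M {x \<in> space M. \<bar>step_seq u n x\<bar> > e} \<le> emeasure M (D n)" for n
      by (intro emeasure_mono) (auto simp: step_seq_def indicator_def split: if_splits)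
    then have "suminf (\<lambda>n. emeasure M {x \<in> space M. \<bar>step_seq u n x\<bar> > e}) \<le> suminf (\<lambda>n. emeasure M (D n))"
      by (intro suminf_le) auto
    also have "\<dots> \<le> ennreal 2"
      using suminf_emeasure_tail_le[of 0] by simp
    also have "\<dots> < \<infinity>" by simp
    finally show "suminf (\<lambda>n. emeasure M {x \<in> space M. \<bar>step_seq u n x\<bar> > e}) < \<infinity>" .
  qed
  then show ?thesis
    unfolding S_c_def by (auto intro!: class_seq_closed exI[of _ "step_seq u"] in_class_seq)
qed

text \<open>Off the union of the sets \<open>D n\<close> with \<open>n \<ge> k\<close>, all
  functions from index \<open>k\<close> on vanish identically, so no bound on \<open>u\<close> is
  required.\<close>

lemma class_seq_step_seq_in_S_au: "class_seq M (step_seq u) \<in> S_au M"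
proof -
  have "tendsto0_almost_unif M (step_seq u)"
    unfolding tendsto0_almost_unif_def
  proof (intro allI impI)
    fix e :: real assume "e > 0"
    \<comment> \<open>Half of \<open>e\<close> compensates the factor 2 in the tail bound.\<close>
    then obtain k where k: "(1/2::real) ^ k < e / 2"
      using real_arch_pow_inv[of "e/2" "1/2"] by auto
    define Z where "Z = (\<Union>n. D (n + k))"
    have Z: "Z \<in> sets M" unfolding Z_def by measurable
    have "emeasure M Z \<le> suminf (\<lambda>n. emeasure M (D (n + k)))"
      unfolding Z_def by (intro emeasure_subadditive_countably) auto
    also have "\<dots> \<le> ennreal (2 * (1/2) ^ k)" by (rule suminf_emeasure_tail_le)
    also have "\<dots> < ennreal e" using k by (intro ennreal_lessI) (use \<open>e > 0\<close> in auto)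
    finally have small: "emeasure M Z < ennreal e" .
    have "step_seq u n x = 0" if "n \<ge> k" "x \<notin> Z" for n x
      using that le_Suc_ex[of k n] by (auto simp: Z_def step_seq_def add.commute indicator_def)
    then have "uniform_limit (space M - Z) (step_seq u) (\<lambda>x. 0) sequentially"
      by (auto simp: uniform_limit_iff intro!: eventually_sequentiallyI[of k])
    with Z small show "\<exists>Z\<in>sets M. emeasure M Z < ennreal e \<and>
        uniform_limit (space M - Z) (step_seq u) (\<lambda>x. 0) sequentially"
      by blast
  qed
  then show ?thesis
    unfolding S_au_def by (auto intro!: class_seq_closed exI[of _ "step_seq u"] in_class_seq)
qed

lemma strongly_c_algebrable_step_seq:
  "strongly_c_algebrable (L0_seq M) ((S_c M \<inter> S_au M) - S_u M)"
proof -
  \<comment> \<open>The exponent \<open>exp t\<close> is positive and injective in \<open>t\<close>,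
    so the whole real line can index the generators.\<close>
  define a where "a t n = exp (real n powr exp t)" for t :: real and n :: nat
  define G where "G t = class_seq M (step_seq (a t))" for t
  have inj_a: "inj a"
  proof (rule injI)
    fix s t assume "a s = a t"
    \<comment> \<open>At \<open>n = 2\<close> the value determines \<open>t\<close>; at 0 and 1 it
      is independent of \<open>t\<close>.\<close>
    then have "a s 2 = a t 2" by simp
    then show "s = t" by (simp add: a_def powr_def)
  qed
  have "inj G"
    using inj_compose[OF inj_class_seq_step_seq inj_a] by (simp add: G_def[abs_def] comp_def)
  then have B: "range G \<approx> (UNIV :: real set)"
    by (metis inj_on_image_eqpoll_self)
  have eval: "poly_eval (L0_seq M) P x \<in> ((S_c M \<inter> S_au M) - S_u M) - {\<zero>\<^bsub>L0_seq M\<^esub>}"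
    if P: "P \<in> polys_no_const N" "P \<noteq> 0" and x: "inj_on x {..<N}" "x ` {..<N} \<subseteq> range G" for N P x
  proof -
    have "\<forall>i\<in>{..<N}. \<exists>t. x i = G t" using x(2) by blast
    then obtain t where t: "\<And>i. i < N \<Longrightarrow> x i = G (t i)"
      by (metis lessThan_iff)
    define p where "p n = mpoly_fun P (\<lambda>i. a (t i) n)" for n
    have "poly_eval (L0_seq M) P x = class_seq M (\<lambda>n w. mpoly_fun P (\<lambda>i. step_seq (a (t i)) n w))"
      using P(1) by (rule poly_eval_class_seq) (auto simp: t G_def)
    also have "(\<lambda>n w. mpoly_fun P (\<lambda>i. step_seq (a (t i)) n w)) = step_seq p"
      using P(1) by (simp add: step_seq_def p_def mpoly_fun_mult_indicator polys_no_const_def fun_eq_iff)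
    finally have eq: "poly_eval (L0_seq M) P x = class_seq M (step_seq p)" .
    \<comment> \<open>Distinct generators have distinct parameters, hence distinct
      exponents.\<close>
    have "inj_on (\<lambda>i. exp (t i)) {..<N}"
      using x(1) by (auto simp: inj_on_def t)
    from mpoly_fun_exp_powr_not_tendsto_0[OF P this]
    have "\<not> p \<longlonglongrightarrow> 0"
      by (simp add: p_def[abs_def] a_def)
    then have "class_seq M (step_seq p) \<notin> S_u M"
      using class_seq_step_seq_in_S_u_imp by blast
    with zero_in_S_u[of M] show ?thesis
      using class_seq_step_seq_in_S_c[of p] class_seq_step_seq_in_S_au[of p] by (auto simp: eq)
  qed
  have "range G \<subseteq> carrier (L0_seq M)"
    by (auto simp: G_def intro: class_seq_closed)
  with B eval show ?thesis
    unfolding strongly_c_algebrable_def by blast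
qed

end

end

text \<open>The same generators work for a larger set; this yields the last two claims from the
  first.\<close>

lemma strongly_c_algebrable_mono:
  "strongly_c_algebrable L A \<Longrightarrow> A \<subseteq> A' \<Longrightarrow> strongly_c_algebrable L A'"
  unfolding strongly_c_algebrable_def by (meson Diff_mono order_refl subsetD)

theorem theorem4p4:
  fixes M :: "'a measure" and A :: "nat \<Rightarrow> 'a set"
  assumes "range A \<subseteq> sets M"
    and "disjoint_family A"
    and "\<And>n. emeasure M (A n) > 0"
    and "(\<lambda>n. emeasure M (A n)) \<longlonglongrightarrow> 0"
  shows "strongly_c_algebrable (L0_seq M) ((S_c M \<inter> S_au M) - S_u M) \<and>
    strongly_c_algebrable (L0_seq M) (S_c M - S_u M) \<and>
    strongly_c_algebrable (L0_seq M) (S_au M - S_u M)"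
proof -
  \<comment> \<open>The measures tend to 0, so they eventually fall below the positive bound
    \<open>(1/2) ^ n\<close>.\<close>
  have "\<exists>k. emeasure M (A k) < ennreal ((1/2) ^ n)" for n
    using eventually_happens'[OF sequentially_bot order_tendstoD(2)[OF assms(4), of "ennreal ((1/2) ^ n)"]]
    by simp
  then obtain k where k: "\<And>n. emeasure M (A (k n)) < ennreal ((1/2) ^ n)"
    by metis
  have "strongly_c_algebrable (L0_seq M) ((S_c M \<inter> S_au M) - S_u M)"
    using assms k by (intro strongly_c_algebrable_step_seq[of "\<lambda>n. A (k n)"]) auto
  then show ?thesis
    by (auto elim!: strongly_c_algebrable_mono)
qed

end
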